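(* Let $d\ge 3$, let $q$ be a prime power, let $V=\mathbb{F}_q^d$ and $1\le k<d/2$. Let $G$ be a group with $\mathrm{PSL}_d(q)\trianglelefteq G\le \mathrm{Aut}(\mathrm{PSL}_d(q))=\mathrm{P}\Gamma\mathrm{L}_d(q)\rtimes\langle\iota\rangle$ and $G\not\le \mathrm{P}\Gamma\mathrm{L}_d(q)$, acting naturally on $$\Omega_k^1=\{\{W,U\}\mid \dim W=k,\ \dim U=d-k,\ V=W\oplus U\}.$$ Then $G$ is not $\mathrm{IBIS}$.
   Context: Here $\iota$ is the graph (inverse-transpose) automorphism, which acts on subspaces of $V$ as the standard polarity sending a $k$-dimensional subspace to a $(d-k)$-dimensional one (reversing inclusions); elements of $G$ outside $\mathrm{P}\Gamma\mathrm{L}_d(q)$ thus act on unordered pairs $\{W,U\}$. A base of a permutation group is a sequence of points with trivial pointwise stabilizer; it is irredundant if each successive stabilizer is strictly smaller. $G$ is $\mathrm{IBIS}$ if all irredundant bases have the same cardinality. *)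

theory Defs
  imports "HOL-Analysis.Analysis" "HOL-Algebra.Bij" "HOL-Algebra.Coset"
begin

text \<open>V = F_q^d is modelled as ('a::{field,finite})^'n with CARD('n) = d and q = CARD('a);
  vector space structure over 'a via the library interpretation vec (scalar mult *s).\<close>

type_synonym ('a,'n) vsub = "('a^'n) set"

definition direct_sum_pair :: "('a::{field,finite}^'n) set \<Rightarrow> ('a^'n) set \<Rightarrow> bool" where
  "direct_sum_pair W U \<longleftrightarrow> W \<inter> U = {0} \<and> {w + u | w u. w \<in> W \<and> u \<in> U} = UNIV"

text \<open>The set Omega_k^1 of unordered pairs {W,U}, dim W = k, dim U = d-k, V = W (+) U.\<close>
definition Omega1 :: "nat \<Rightarrow> ('a::{field,finite}^'n::finite) set set set" where
  "Omega1 k = {{W, U} | W U. vec.subspace W \<and> vec.subspace U \<and> vec.dim W = k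
                 \<and> vec.dim U = CARD('n) - k \<and> direct_sum_pair W U}"

text \<open>Permutation of Omega induced by a map on subspaces (extensional, as in BijGroup).\<close>
definition induced :: "('a set \<Rightarrow> 'a set) \<Rightarrow> 'a set set set \<Rightarrow> ('a set set \<Rightarrow> 'a set set)" where
  "induced h Om = (\<lambda>P\<in>Om. h ` P)"

text \<open>Field automorphisms and semilinear bijections of V.\<close>
definition field_aut :: "('a::field \<Rightarrow> 'a) \<Rightarrow> bool" where
  "field_aut s \<longleftrightarrow> bij s \<and> (\<forall>a b. s (a + b) = s a + s b) \<and> (\<forall>a b. s (a * b) = s a * s b)"

definition semilinear_bij :: "('a::field^'n \<Rightarrow> 'a^'n) \<Rightarrow> bool" where
  "semilinear_bij g \<longleftrightarrow> bij g \<and> (\<exists>s. field_aut s \<and>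
     (\<forall>x y. g (x + y) = g x + g y) \<and> (\<forall>c x. g (c *s x) = s c *s g x))"

text \<open>Standard polarity: orthogonal complement w.r.t. the standard bilinear form.\<close>
definition perp :: "('a::field^'n) set \<Rightarrow> ('a^'n) set" where
  "perp W = {x. \<forall>w\<in>W. (\<Sum>i\<in>UNIV. x $ i * w $ i) = 0}"

text \<open>PSL_d(q), PGammaL_d(q) and Aut(PSL_d(q)) = PGammaL_d(q) semidirect <iota>, as permutation
  groups on Omega_k^1 (the actions are faithful).\<close>
definition PSL_on :: "nat \<Rightarrow> (('a::{field,finite}^'n::finite) set set \<Rightarrow> ('a^'n) set set) set" where
  "PSL_on k = {induced (image (\<lambda>x. A *v x)) (Omega1 k) | A :: 'a^'n^'n. det A = 1}"

definition PGammaL_on :: "nat \<Rightarrow> (('a::{field,finite}^'n::finite) set set \<Rightarrow> ('a^'n) set set) set" where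
  "PGammaL_on k = {induced (image g) (Omega1 k) | g :: 'a^'n \<Rightarrow> 'a^'n. semilinear_bij g}"

definition iota_on :: "nat \<Rightarrow> (('a::{field,finite}^'n::finite) set set \<Rightarrow> ('a^'n) set set)" where
  "iota_on k = induced perp (Omega1 k)"

definition Aut_on :: "nat \<Rightarrow> (('a::{field,finite}^'n::finite) set set \<Rightarrow> ('a^'n) set set) set" where
  "Aut_on k = PGammaL_on k \<union> {compose (Omega1 k) (iota_on k) g | g. g \<in> PGammaL_on k}"

text \<open>Bases, irredundant bases, IBIS for a permutation group G on Om.\<close>
definition pw_stab :: "('b \<Rightarrow> 'b) set \<Rightarrow> 'b list \<Rightarrow> ('b \<Rightarrow> 'b) set" where
  "pw_stab G B = {g \<in> G. \<forall>b \<in> set B. g b = b}"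

definition is_base :: "'b set \<Rightarrow> ('b \<Rightarrow> 'b) set \<Rightarrow> 'b list \<Rightarrow> bool" where
  "is_base Om G B \<longleftrightarrow> set B \<subseteq> Om \<and> pw_stab G B = {\<lambda>x\<in>Om. x}"

definition irredundant_base :: "'b set \<Rightarrow> ('b \<Rightarrow> 'b) set \<Rightarrow> 'b list \<Rightarrow> bool" where
  "irredundant_base Om G B \<longleftrightarrow> is_base Om G B \<and>
     (\<forall>i < length B. pw_stab G (take (Suc i) B) \<subset> pw_stab G (take i B))"

definition IBIS :: "'b set \<Rightarrow> ('b \<Rightarrow> 'b) set \<Rightarrow> bool" where
  "IBIS Om G \<longleftrightarrow> (\<forall>B B'. irredundant_base Om G B \<and> irredundant_base Om G B' \<longrightarrow> length B = length B')"

end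

theory Submission
  imports Defs
begin

text \<open>Choose disjoint k-sets A and B of coordinates, a bijection \<open>\<phi> : A \<rightarrow> B\<close> and a
  coordinate c0 outside \<open>A \<union> B\<close>. Consider the points \<open>P1 = {\<langle>A\<rangle>, \<langle>-A\<rangle>}\<close>,
  \<open>Q = {\<langle>B\<rangle>, \<langle>-B\<rangle>}\<close> and \<open>P2 = {D, \<langle>-B\<rangle>}\<close> of \<open>\<Omega>\<close>, where D is spanned
  by the vectors \<open>e\<^sub>i + e\<^sub>\<phi>\<^sub>i\<close>. As \<open>k \<noteq> d - k\<close>, a semilinear map fixing P1 and P2
  fixes \<open>\<langle>A\<rangle>\<close>, \<open>\<langle>-A\<rangle>\<close>, D and \<open>\<langle>-B\<rangle>\<close>, hence also
  \<open>\<langle>B\<rangle> = (\<langle>A\<rangle> + D) \<inter> \<langle>-A\<rangle>\<close>, so it fixes Q; and no element outside PGammaL fixes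
  both P1 and P2. Thus the stabiliser of (P1, P2) fixes Q, whereas the stabilisers along
  (P1, Q, P2) strictly decrease: transvections witness the first two steps, a diagonal
  matrix of determinant 1 the third one if q > 2, and for q = 2 the polarity itself,
  which then lies in G. Extending (P1, Q, P2) and (P1, P2) greedily by the same points
  gives irredundant bases of different lengths.\<close>


section \<open>Irredundant sequences and bases\<close>

definition irredundant_seq :: "('b \<Rightarrow> 'b) set \<Rightarrow> 'b list \<Rightarrow> bool" where
  "irredundant_seq G B \<longleftrightarrow> (\<forall>i < length B. pw_stab G (take (Suc i) B) \<subset> pw_stab G (take i B))"

lemma irredundant_base_iff: "irredundant_base Om G B \<longleftrightarrow> is_base Om G B \<and> irredundant_seq G B"
  unfolding irredundant_base_def irredundant_seq_def ..

lemma pw_stab_append: "pw_stab G (xs @ ys) = pw_stab G xs \<inter> pw_stab G ys"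
  unfolding pw_stab_def by auto

lemma pw_stab_snoc: "pw_stab G (xs @ [b]) = {g \<in> pw_stab G xs. g b = b}"
  unfolding pw_stab_def by auto

lemma irredundant_seq_iff_moved:
  "irredundant_seq G B \<longleftrightarrow> (\<forall>i < length B. \<exists>g \<in> pw_stab G (take i B). g (B ! i) \<noteq> B ! i)"
proof -
  have "pw_stab G (take (Suc i) B) \<subset> pw_stab G (take i B) \<longleftrightarrow>
      (\<exists>g \<in> pw_stab G (take i B). g (B ! i) \<noteq> B ! i)" if "i < length B" for i
    unfolding take_Suc_conv_app_nth[OF that] pw_stab_snoc by blast
  then show ?thesis
    unfolding irredundant_seq_def by blast
qed

lemma irredundant_seq_snoc:
  assumes "irredundant_seq G xs" "pw_stab G (xs @ [b]) \<subset> pw_stab G xs"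
  shows "irredundant_seq G (xs @ [b])"
  unfolding irredundant_seq_def
proof (intro allI impI)
  fix i assume "i < length (xs @ [b])"
  then consider "i < length xs" | "i = length xs" by fastforce
  then show "pw_stab G (take (Suc i) (xs @ [b])) \<subset> pw_stab G (take i (xs @ [b]))"
    using assms unfolding irredundant_seq_def by cases simp_all
qed

fun prune :: "('b \<Rightarrow> 'b) set \<Rightarrow> 'b list \<Rightarrow> 'b list \<Rightarrow> 'b list" where
  "prune G xs [] = xs"
| "prune G xs (b # bs) =
     (if pw_stab G (xs @ [b]) \<subset> pw_stab G xs then prune G (xs @ [b]) bs else prune G xs bs)"

lemma prune_eq_append: "\<exists>R. prune G xs bs = xs @ R \<and> length R \<le> length bs \<and> set R \<subseteq> set bs"
proof (induction G xs bs rule: prune.induct)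
  case (2 G xs b bs)
  show ?case
  proof (cases "pw_stab G (xs @ [b]) \<subset> pw_stab G xs")
    case True
    with "2.IH"(1) obtain R where "prune G (xs @ [b]) bs = (xs @ [b]) @ R"
      "length R \<le> length bs" "set R \<subseteq> set bs" by blast
    with True show ?thesis by (intro exI[of _ "b # R"]) auto
  next
    case False
    with "2.IH"(2) obtain R where "prune G xs bs = xs @ R"
      "length R \<le> length bs" "set R \<subseteq> set bs" by blast
    with False show ?thesis by (intro exI[of _ R]) auto
  qed
qed simp

lemma pw_stab_prune: "pw_stab G (prune G xs bs) = pw_stab G (xs @ bs)"
proof (induction G xs bs rule: prune.induct)
  case (2 G xs b bs)
  show ?case
  proof (cases "pw_stab G (xs @ [b]) \<subset> pw_stab G xs")
    case True
    with "2.IH"(1) show ?thesis by simp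
  next
    case False
    then have "pw_stab G (xs @ [b]) = pw_stab G xs"
      by (auto simp: pw_stab_snoc)
    then have "pw_stab G (xs @ b # bs) = pw_stab G (xs @ bs)"
      using pw_stab_append[of G "xs @ [b]" bs] pw_stab_append[of G xs bs] by simp
    with False "2.IH"(2) show ?thesis by simp
  qed
qed simp

lemma irredundant_seq_prune: "irredundant_seq G xs \<Longrightarrow> irredundant_seq G (prune G xs bs)"
proof (induction G xs bs rule: prune.induct)
  case (2 G xs b bs)
  then show ?case
    by (cases "pw_stab G (xs @ [b]) \<subset> pw_stab G xs") (simp_all add: irredundant_seq_snoc)
qed simp

lemma subgroup_BijGroupD:
  assumes "subgroup G (BijGroup Om)"
  shows subgroup_BijGroup_subset: "G \<subseteq> Bij Om"
    and subgroup_BijGroup_id: "(\<lambda>x\<in>Om. x) \<in> G"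
    and subgroup_BijGroup_compose: "\<lbrakk>g \<in> G; f \<in> G\<rbrakk> \<Longrightarrow> compose Om g f \<in> G"
proof -
  show G: "G \<subseteq> Bij Om"
    using subgroup.subset[OF assms] by (simp add: BijGroup_def)
  show "(\<lambda>x\<in>Om. x) \<in> G"
    using subgroup.one_closed[OF assms] by (simp add: BijGroup_def)
  assume "g \<in> G" "f \<in> G"
  moreover from this G have "g \<otimes>\<^bsub>BijGroup Om\<^esub> f = compose Om g f"
    by (auto simp: BijGroup_def)
  ultimately show "compose Om g f \<in> G"
    using subgroup.m_closed[OF assms] by metis
qed

lemma pw_stab_all_points:
  assumes G: "subgroup G (BijGroup Om)" and L: "set L = Om"
  shows "pw_stab G L \<subseteq> {\<lambda>x\<in>Om. x}"
proof
  fix g assume g: "g \<in> pw_stab G L"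
  then have "g \<in> extensional Om"
    using subgroup_BijGroup_subset[OF G] Bij_imp_extensional unfolding pw_stab_def by blast
  with g L show "g \<in> {\<lambda>x\<in>Om. x}"
    unfolding pw_stab_def by (auto intro: extensionalityI[of _ Om])
qed

lemma id_in_pw_stab:
  assumes "subgroup G (BijGroup Om)" and "set L \<subseteq> Om"
  shows "(\<lambda>x\<in>Om. x) \<in> pw_stab G L"
  using subgroup_BijGroup_id[OF assms(1)] assms(2) unfolding pw_stab_def by auto

lemma irredundant_base_prune:
  assumes G: "subgroup G (BijGroup Om)" and "irredundant_seq G xs" and "set (xs @ bs) \<subseteq> Om"
    and "pw_stab G (xs @ bs) \<subseteq> {\<lambda>x\<in>Om. x}"
  shows "irredundant_base Om G (prune G xs bs)"
proof -
  obtain R where "prune G xs bs = xs @ R" "set R \<subseteq> set bs"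
    using prune_eq_append[of G xs bs] by blast
  then have "set (prune G xs bs) \<subseteq> Om"
    using assms(3) by auto
  moreover have "pw_stab G (prune G xs bs) = {\<lambda>x\<in>Om. x}"
    using assms(4) id_in_pw_stab[OF G assms(3)] unfolding pw_stab_prune
    by (metis empty_iff subset_singleton_iff)
  ultimately show ?thesis
    using irredundant_seq_prune[OF assms(2)] unfolding irredundant_base_iff is_base_def by simp
qed

lemma not_IBIS_if_shorter_seq_fixes:
  assumes G: "subgroup G (BijGroup Om)" and "finite Om"
    and X: "irredundant_seq G X" "set X \<subseteq> Om" and Y: "set Y \<subseteq> Om"
    and shorter: "length Y < length X" and stab_YX: "pw_stab G Y \<subseteq> pw_stab G X"
  shows "\<not> IBIS Om G"
proof
  assume IBIS: "IBIS Om G"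
  obtain L where L: "set L = Om"
    using finite_list[OF \<open>finite Om\<close>] by blast
  obtain R where R: "prune G X L = X @ R" "set R \<subseteq> set L"
    using prune_eq_append[of G X L] by blast
  have stab_XL: "pw_stab G (X @ L) \<subseteq> {\<lambda>x\<in>Om. x}"
    using pw_stab_all_points[OF G L] pw_stab_append[of G X L] by blast
  have base_X: "irredundant_base Om G (X @ R)"
    using irredundant_base_prune[OF G X(1) _ stab_XL] X(2) L R(1) by simp
  have "pw_stab G (Y @ R) \<subseteq> pw_stab G (X @ R)"
    using stab_YX unfolding pw_stab_append by blast
  also have "\<dots> \<subseteq> {\<lambda>x\<in>Om. x}"
    using stab_XL pw_stab_prune[of G X L] R(1) by simp
  finally have base_Y: "irredundant_base Om G (prune G [] (Y @ R))"
    using irredundant_base_prune[of G Om "[]" "Y @ R"] G Y R(2) L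
    by (simp add: irredundant_seq_def)
  obtain R' where "prune G [] (Y @ R) = R'" "length R' \<le> length (Y @ R)"
    using prune_eq_append[of G "[]" "Y @ R"] by auto
  with base_X base_Y IBIS shorter show False
    unfolding IBIS_def by fastforce
qed


section \<open>Coordinate subspaces\<close>

definition coord_subspace :: "'n set \<Rightarrow> ('a::field^'n) set" where
  "coord_subspace S = {x. \<forall>i. i \<notin> S \<longrightarrow> x $ i = 0}"

lemma coord_subspaceD: "x \<in> coord_subspace S \<Longrightarrow> i \<notin> S \<Longrightarrow> x $ i = 0"
  unfolding coord_subspace_def by blast

lemma axis_in_coord_subspace_iff: "axis i c \<in> coord_subspace S \<longleftrightarrow> c = 0 \<or> i \<in> S"
  unfolding coord_subspace_def axis_def by auto

lemma subspace_coord_subspace: "vec.subspace (coord_subspace S)"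
  unfolding coord_subspace_def using subspace_substandard_cart[of "\<lambda>i. i \<notin> S"] by simp

lemma dim_coord_subspace: "vec.dim (coord_subspace S :: ('a::field^'n::finite) set) = card S"
  unfolding coord_subspace_def by (rule dim_substandard_cart)

lemma card_coord_subspace:
  "card (coord_subspace S :: ('a::{field,finite}^'n::finite) set) = CARD('a) ^ card S"
proof -
  have "bij_betw (\<lambda>x. restrict (\<lambda>i. x $ i) S) (coord_subspace S :: ('a^'n) set) (S \<rightarrow>\<^sub>E UNIV)"
    by (rule bij_betw_byWitness[where f' = "\<lambda>f. \<chi> i. if i \<in> S then f i else 0"])
      (auto simp: coord_subspace_def vec_eq_iff PiE_def extensional_def fun_eq_iff)
  then show ?thesis
    by (simp add: bij_betw_same_card card_PiE)
qed

lemma card_subspace: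
  assumes "vec.subspace (W :: ('a::{field,finite}^'n::finite) set)"
  shows "card W = CARD('a) ^ vec.dim W"
proof -
  have "vec.dim W \<le> CARD('n)"
    by (metis vec.dim_subset subset_UNIV vec_dim_card)
  then obtain S :: "'n set" where S: "card S = vec.dim W"
    using obtain_subset_with_card_n by (metis finite_UNIV card_mono subset_UNIV)
  then obtain f where "f ` W = (coord_subspace S :: ('a^'n) set)" "inj_on f W"
    using vec.subspace_isomorphism[OF assms subspace_coord_subspace, of S]
    by (auto simp: dim_coord_subspace)
  then show ?thesis
    using card_coord_subspace S card_image by metis
qed

lemma one_less_card_field: "1 < CARD('a::{field,finite})"
  using card_mono[of UNIV "{0, 1 :: 'a}"] by simp

lemma dim_eq_if_card_eq:
  fixes W U :: "('a::{field,finite}^'n::finite) set"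
  assumes "vec.subspace W" "vec.subspace U" "card W = card U"
  shows "vec.dim W = vec.dim U"
  using assms card_subspace one_less_card_field[where 'a='a] by (metis power_inject_exp)

lemma coord_subspace_empty [simp]: "coord_subspace {} = {0}"
  unfolding coord_subspace_def by (auto simp: vec_eq_iff)

lemma coord_subspace_UNIV [simp]: "coord_subspace UNIV = UNIV"
  unfolding coord_subspace_def by simp

lemma coord_subspace_Int: "coord_subspace S \<inter> coord_subspace T = coord_subspace (S \<inter> T)"
  unfolding coord_subspace_def by auto

lemma coord_subspace_plus:
  "coord_subspace S + coord_subspace T = (coord_subspace (S \<union> T) :: ('a::field^'n) set)"
proof
  show "coord_subspace S + coord_subspace T \<subseteq> coord_subspace (S \<union> T)"
    unfolding coord_subspace_def set_plus_def by auto
  show "(coord_subspace (S \<union> T) :: ('a^'n) set) \<subseteq> coord_subspace S + coord_subspace T"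
  proof
    fix v :: "'a^'n" assume v: "v \<in> coord_subspace (S \<union> T)"
    let ?s = "\<chi> i. if i \<in> S then v $ i else 0"
    have "?s \<in> coord_subspace S" "v - ?s \<in> coord_subspace T"
      using v unfolding coord_subspace_def by auto
    then have "?s + (v - ?s) \<in> coord_subspace S + coord_subspace T"
      by (rule set_plus_intro)
    then show "v \<in> coord_subspace S + coord_subspace T"
      by simp
  qed
qed

lemma direct_sum_pair_iff: "direct_sum_pair W U \<longleftrightarrow> W \<inter> U = {0} \<and> W + U = UNIV"
proof -
  have "{w + u | w u. w \<in> W \<and> u \<in> U} = W + U"
    unfolding set_plus_def by auto
  then show ?thesis
    unfolding direct_sum_pair_def by simp
qed

lemma direct_sum_pair_coord_subspace: "direct_sum_pair (coord_subspace S) (coord_subspace (- S))"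
  unfolding direct_sum_pair_iff coord_subspace_Int coord_subspace_plus by simp

lemma perp_coord_subspace: "perp (coord_subspace S :: ('a::field^'n::finite) set) = coord_subspace (- S)"
proof
  show "perp (coord_subspace S) \<subseteq> (coord_subspace (- S) :: ('a^'n) set)"
  proof
    fix x :: "'a^'n" assume x: "x \<in> perp (coord_subspace S)"
    have "x $ i = 0" if "i \<in> S" for i
    proof -
      have "axis i 1 \<in> (coord_subspace S :: ('a^'n) set)"
        using that by (simp add: axis_in_coord_subspace_iff)
      with x have "(\<Sum>j\<in>UNIV. x $ j * axis i 1 $ j) = 0"
        unfolding perp_def by blast
      then show ?thesis
        by (simp add: axis_def if_distrib cong: if_cong)
    qed
    then show "x \<in> coord_subspace (- S)"
      by (auto simp: coord_subspace_def)
  qed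
  show "coord_subspace (- S) \<subseteq> perp (coord_subspace S :: ('a^'n) set)"
    unfolding coord_subspace_def perp_def
    by (auto intro!: sum.neutral) (metis mult_zero_left mult_zero_right)
qed

lemma subset_perp_perp: "X \<subseteq> perp (perp X)"
  unfolding perp_def by (auto simp: mult.commute)


section \<open>Semilinear maps and the action on pairs of complements\<close>

lemma semilinear_bijE:
  assumes "semilinear_bij h"
  obtains s where "field_aut s" "bij h" "\<And>x y. h (x + y) = h x + h y"
    "\<And>c x. h (c *s x) = s c *s h x"
  using assms unfolding semilinear_bij_def by blast

lemma semilinear_bij_zero: "semilinear_bij h \<Longrightarrow> h 0 = 0"
  by (metis semilinear_bijE add_cancel_right_right add_0)

lemma semilinear_bij_inj: "semilinear_bij h \<Longrightarrow> inj h"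
  by (metis semilinear_bijE bij_is_inj)

lemma subspace_semilinear_image:
  assumes h: "semilinear_bij h" and W: "vec.subspace W"
  shows "vec.subspace (h ` W)"
proof -
  obtain s where s: "field_aut s" "\<And>x y. h (x + y) = h x + h y" "\<And>c x. h (c *s x) = s c *s h x"
    using h by (auto elim: semilinear_bijE)
  have "surj s"
    using s(1) unfolding field_aut_def by (simp add: bij_is_surj)
  then have "c *s h x \<in> h ` W" if "x \<in> W" for c x
    using that s(3) W vec.subspace_scale by (metis image_eqI surj_f_inv_f)
  moreover have "h x + h y \<in> h ` W" if "x \<in> W" "y \<in> W" for x y
    using that s(2) W vec.subspace_add by (metis image_eqI)
  moreover have "0 \<in> h ` W"
    using W semilinear_bij_zero[OF h] vec.subspace_0 by (metis image_eqI)
  ultimately show ?thesis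
    unfolding vec.subspace_def by blast
qed

lemma dim_semilinear_image:
  assumes h: "semilinear_bij (h :: ('a::{field,finite}^'n::finite) \<Rightarrow> _)" and W: "vec.subspace W"
  shows "vec.dim (h ` W) = vec.dim W"
  using dim_eq_if_card_eq[OF subspace_semilinear_image[OF h W] W] semilinear_bij_inj[OF h]
  by (simp add: card_image inj_on_subset)

lemma additive_image_set_plus:
  assumes "\<And>x y. h (x + y) = h x + h y"
  shows "h ` (X + Y) = h ` X + h ` Y"
  unfolding set_plus_def using assms by (auto simp: image_iff) metis

lemma semilinear_image_set_plus: "semilinear_bij h \<Longrightarrow> h ` (X + Y) = h ` X + h ` Y"
  by (metis semilinear_bijE additive_image_set_plus)

lemma direct_sum_pair_semilinear_image:
  assumes h: "semilinear_bij h" and "direct_sum_pair W U"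
  shows "direct_sum_pair (h ` W) (h ` U)"
proof -
  have "h ` W \<inter> h ` U = h ` (W \<inter> U)"
    using semilinear_bij_inj[OF h] by (simp add: image_Int)
  moreover have "h ` W + h ` U = h ` (W + U)"
    using semilinear_image_set_plus[OF h] by simp
  moreover have "surj h"
    using h unfolding semilinear_bij_def by (simp add: bij_is_surj)
  ultimately show ?thesis
    using assms(2) semilinear_bij_zero[OF h] unfolding direct_sum_pair_iff by simp
qed

lemma Omega1_memI:
  assumes "vec.subspace W" "vec.subspace U" "vec.dim W = k" "vec.dim U = CARD('n) - k"
    and "direct_sum_pair W (U :: ('a::{field,finite}^'n::finite) set)"
  shows "{W, U} \<in> Omega1 k"
  unfolding Omega1_def using assms by blast

lemma semilinear_image_Omega1:
  assumes h: "semilinear_bij h" and "P \<in> (Omega1 k :: ('a::{field,finite}^'n::finite) set set set)"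
  shows "image h ` P \<in> Omega1 k"
proof -
  obtain W U where "P = {W, U}" "vec.subspace W" "vec.subspace U" "vec.dim W = k"
    "vec.dim U = CARD('n) - k" "direct_sum_pair W U"
    using assms(2) unfolding Omega1_def by blast
  then show ?thesis
    by (auto intro!: Omega1_memI subspace_semilinear_image[OF h]
        direct_sum_pair_semilinear_image[OF h] simp: dim_semilinear_image[OF h])
qed

lemma induced_apply: "P \<in> Om \<Longrightarrow> induced h Om P = h ` P"
  unfolding induced_def by simp

lemma compose_iota_on_apply:
  assumes "semilinear_bij h" and "P \<in> Omega1 k"
  shows "compose (Omega1 k) (iota_on k) (induced (image h) (Omega1 k)) P = perp ` image h ` P"
  using assms semilinear_image_Omega1[OF assms] unfolding compose_def iota_on_def induced_def by simp

lemma Aut_onE: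
  assumes "g \<in> Aut_on k"
  obtains (PGammaL) h where "semilinear_bij h"
      "\<And>P. P \<in> (Omega1 k :: ('a::{field,finite}^'n::finite) set set set) \<Longrightarrow> g P = image h ` P"
  | (polarity) h where "semilinear_bij h"
      "\<And>P. P \<in> (Omega1 k :: ('a::{field,finite}^'n::finite) set set set) \<Longrightarrow> g P = perp ` image h ` P"
proof -
  consider (PGammaL') h where "semilinear_bij h" "g = induced (image h) (Omega1 k)"
    | (polarity') h where "semilinear_bij h"
      "g = compose (Omega1 k) (iota_on k) (induced (image h) (Omega1 k))"
    using assms unfolding Aut_on_def PGammaL_on_def by blast
  then show ?thesis
  proof cases
    case (PGammaL' h)
    then show ?thesis
      using PGammaL induced_apply by metis
  next
    case (polarity' h)
    then show ?thesis
      using polarity compose_iota_on_apply by metis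
  qed
qed

lemma matrix_in_PSL_on: "det M = 1 \<Longrightarrow> induced (image ((*v) M)) (Omega1 k) \<in> PSL_on k"
  unfolding PSL_on_def by blast


section \<open>The polarity over GF(2)\<close>

lemma card_2_field_cases:
  assumes "CARD('a::{field,finite}) = 2"
  shows "(x::'a) = 0 \<or> x = 1"
proof -
  have "{0, 1::'a} = UNIV"
    using assms by (intro card_subset_eq) simp_all
  then show ?thesis by blast
qed

lemma field_aut_card_2:
  assumes "CARD('a::{field,finite}) = 2" and s: "field_aut s"
  shows "s (x::'a) = x"
proof -
  have "s 0 = 0"
    using s unfolding field_aut_def by (metis add_cancel_right_right add_0)
  moreover have "s 1 \<noteq> s 0"
    using s unfolding field_aut_def by (metis bij_is_inj inj_eq zero_neq_one)
  ultimately show ?thesis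
    using card_2_field_cases[OF assms(1)] by metis
qed

lemma ex_field_elem_neq_0_1:
  assumes "CARD('a::{field,finite}) \<noteq> 2"
  shows "\<exists>l::'a. l \<noteq> 0 \<and> l \<noteq> 1"
proof -
  have "UNIV \<noteq> {0, 1::'a}"
    using assms by (metis card_2_iff zero_neq_one)
  then show ?thesis
    by blast
qed

lemma semilinear_bij_card_2_right_inverse:
  fixes h :: "'a::{field,finite}^'n::finite \<Rightarrow> 'a^'n"
  assumes q: "CARD('a) = 2" and h: "semilinear_bij h"
  obtains M :: "'a^'n^'n" where "det M = 1" "\<And>x. h (M *v x) = x"
proof -
  obtain s where s: "field_aut s" "bij h" "\<And>x y. h (x + y) = h x + h y"
    "\<And>c x. h (c *s x) = s c *s h x"
    using h by (auto elim: semilinear_bijE)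
  have "Vector_Spaces.linear (*s) (*s) h"
    unfolding Vector_Spaces.linear_iff
    using s(3,4) field_aut_card_2[OF q s(1)] vec.vector_space_axioms by simp
  then have h_matrix: "h x = matrix h *v x" for x
    by (simp add: matrix_works)
  then have "inj ((*v) (matrix h))"
    using bij_is_inj[OF s(2)] by (metis inj_on_cong)
  then obtain M where "M ** matrix h = mat 1"
    using matrix_left_invertible_injective by blast
  then have inverse: "matrix h ** M = mat 1"
    using matrix_left_right_inverse by blast
  then have "det M \<noteq> 0"
    using det_mul[of "matrix h" M] by auto
  then have "det M = 1"
    using card_2_field_cases[OF q] by blast
  moreover have "h (M *v x) = x" for x
    using inverse by (simp add: h_matrix matrix_vector_mul_assoc)
  ultimately show ?thesis
    using that by blast
qed

text \<open>Over GF(2) every semilinear bijection is linear of determinant 1, so an element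
  of G outside PGammaL differs from the polarity by an element of PSL.\<close>

lemma iota_on_in_subgroup_if_card_2:
  assumes G: "subgroup G (BijGroup (Omega1 k :: ('a::{field,finite}^'n::finite) set set set))"
    and "PSL_on k \<subseteq> G" and "G \<subseteq> Aut_on k" and "\<not> G \<subseteq> PGammaL_on k"
    and q: "CARD('a) = 2"
  shows "iota_on k \<in> G"
proof -
  let ?Om = "Omega1 k :: ('a^'n) set set set"
  obtain g h where g: "g \<in> G" and h: "semilinear_bij h"
    and g_eq: "g = compose ?Om (iota_on k) (induced (image h) ?Om)"
    using assms(3,4) unfolding Aut_on_def PGammaL_on_def by blast
  obtain M :: "'a^'n^'n" where "det M = 1" and M: "\<And>x. h (M *v x) = x"
    using semilinear_bij_card_2_right_inverse[OF q h] by blast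
  define f where "f = induced (image ((*v) M)) ?Om"
  have f: "f \<in> G"
    using matrix_in_PSL_on[OF \<open>det M = 1\<close>] assms(2) unfolding f_def by blast
  have "compose ?Om g f = iota_on k"
  proof
    fix P
    show "compose ?Om g f P = iota_on k P"
    proof (cases "P \<in> ?Om")
      case True
      then have "f P \<in> ?Om"
        using f subgroup_BijGroup_subset[OF G] Bij_imp_funcset by blast
      moreover have "image h ` f P = P"
        using True M unfolding f_def induced_def by (simp add: image_image)
      ultimately show ?thesis
        using True compose_iota_on_apply[OF h] unfolding g_eq compose_def iota_on_def induced_def
        by simp
    qed (simp add: compose_def iota_on_def induced_def)
  qed
  then show ?thesis
    using subgroup_BijGroup_compose[OF G g f] by simp
qed

section \<open>Transvections and diagonal matrices\<close>

definition transvection :: "'n \<Rightarrow> 'n \<Rightarrow> 'a::field^'n^'n" where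
  "transvection i j = (\<chi> r. if r = i then row i (mat 1) + row j (mat 1) else row r (mat 1))"

lemma det_transvection: "i \<noteq> j \<Longrightarrow> det (transvection i j :: 'a::field^'n::finite^'n) = 1"
  using det_row_operation[of i j "mat 1 :: 'a^'n^'n" 1]
  unfolding vector_smult_lid transvection_def by simp

lemma transvection_entry:
  "transvection i j $ r $ c = (if r = i \<and> c = j then 1 else 0) + (if r = c then 1 else (0::'a::field))"
  by (simp add: transvection_def row_def mat_def)

lemma transvection_apply:
  "(transvection i j *v x) $ r = x $ r + (if r = i then x $ j else 0)"
proof -
  have "(transvection i j *v x) $ r =
      (\<Sum>c\<in>UNIV. (if r = i \<and> c = j then x $ c else 0) + (if r = c then x $ c else 0))"
    unfolding matrix_vector_mult_def transvection_entry distrib_right vec_lambda_beta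
    by (intro sum.cong) auto
  then show ?thesis
    by (simp add: sum.distrib)
qed

lemma inj_transvection:
  assumes "i \<noteq> j"
  shows "inj ((*v) (transvection i j :: 'a::field^'n::finite^'n))"
proof (rule injI)
  fix x y :: "'a^'n"
  assume "transvection i j *v x = transvection i j *v y"
  then have eq: "x $ r + (if r = i then x $ j else 0) = y $ r + (if r = i then y $ j else 0)" for r
    by (metis transvection_apply)
  then have "x $ j = y $ j"
    using assms by (metis add.right_neutral)
  with eq show "x = y"
    unfolding vec_eq_iff by (metis add_right_cancel)
qed

lemma transvection_image_coord_subspace:
  assumes "i \<noteq> j" and "j \<in> S \<Longrightarrow> i \<in> S"
  shows "(*v) (transvection i j) ` coord_subspace S = (coord_subspace S :: ('a::{field,finite}^'n::finite) set)"
proof (rule endo_inj_surj)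
  show "(*v) (transvection i j) ` coord_subspace S \<subseteq> (coord_subspace S :: ('a^'n) set)"
    using assms(2) unfolding coord_subspace_def by (fastforce simp: transvection_apply)
  show "inj_on ((*v) (transvection i j)) (coord_subspace S :: ('a^'n) set)"
    using inj_transvection[OF assms(1)] by (rule inj_on_subset) simp
qed simp

definition diag_matrix :: "('n \<Rightarrow> 'a::field) \<Rightarrow> 'a^'n^'n" where
  "diag_matrix d = (\<chi> r c. if r = c then d r else 0)"

lemma diag_matrix_apply: "(diag_matrix d *v x) $ r = d r * x $ (r::'n::finite)"
proof -
  have "(diag_matrix d *v x) $ r = (\<Sum>c\<in>UNIV. if r = c then d r * x $ c else 0)"
    unfolding matrix_vector_mult_def diag_matrix_def vec_lambda_beta by (intro sum.cong) auto
  then show ?thesis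
    by simp
qed

lemma det_diag_matrix: "det (diag_matrix d :: 'a::field^'n::finite^'n) = prod d UNIV"
  using det_diagonal[of "diag_matrix d"] by (simp add: diag_matrix_def)

lemma diag_matrix_image_coord_subspace:
  assumes "\<And>r. d r \<noteq> 0"
  shows "(*v) (diag_matrix d) ` coord_subspace S = (coord_subspace S :: ('a::{field,finite}^'n::finite) set)"
proof (rule endo_inj_surj)
  show "(*v) (diag_matrix d) ` coord_subspace S \<subseteq> (coord_subspace S :: ('a^'n) set)"
    unfolding coord_subspace_def by (auto simp: diag_matrix_apply)
  have "inj ((*v) (diag_matrix d) :: 'a^'n \<Rightarrow> 'a^'n)"
    using assms by (intro injI) (simp add: vec_eq_iff diag_matrix_apply)
  then show "inj_on ((*v) (diag_matrix d)) (coord_subspace S :: ('a^'n) set)"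
    by (rule inj_on_subset) simp
qed simp

lemma image_pair_neq:
  assumes "v \<in> W" "f v \<notin> W" "f v \<notin> U"
  shows "{f ` W, f ` U} \<noteq> {W, U}"
  using assms by (auto simp: doubleton_eq_iff)


section \<open>Coordinate pairs and diagonal pairs\<close>

definition coord_pair :: "'n set \<Rightarrow> ('a::field^'n) set set" where
  "coord_pair S = {coord_subspace S, coord_subspace (- S)}"

lemma card_Compl_finite: "card (- S) = CARD('n::finite) - card (S :: 'n set)"
  by (simp add: Compl_eq_Diff_UNIV card_Diff_subset)

lemma coord_pair_in_Omega1:
  "card S = k \<Longrightarrow> (coord_pair S :: ('a::{field,finite}^'n::finite) set set) \<in> Omega1 k"
  unfolding coord_pair_def
  by (intro Omega1_memI subspace_coord_subspace direct_sum_pair_coord_subspace)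
    (simp_all add: dim_coord_subspace card_Compl_finite)

lemma perp_image_coord_pair: "perp ` coord_pair S = (coord_pair S :: ('a::field^'n::finite) set set)"
  unfolding coord_pair_def by (auto simp: perp_coord_subspace)

lemma transvection_moves_coord_pair:
  assumes "i \<notin> S" "j \<in> S"
  shows "image ((*v) (transvection i j)) ` coord_pair S \<noteq>
    (coord_pair S :: ('a::field^'n::finite) set set)"
proof -
  let ?v = "axis j 1 :: 'a^'n"
  have "?v \<in> coord_subspace S"
    using assms(2) by (simp add: axis_in_coord_subspace_iff)
  moreover have "(transvection i j *v ?v) $ i = 1" "(transvection i j *v ?v) $ j = 1"
    using assms by (auto simp: transvection_apply axis_def)
  then have "transvection i j *v ?v \<notin> coord_subspace S"
    "transvection i j *v ?v \<notin> coord_subspace (- S)"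
    using assms unfolding coord_subspace_def by auto
  ultimately show ?thesis
    unfolding coord_pair_def by (simp add: image_pair_neq)
qed

lemma transvection_fixes_coord_pair:
  assumes "i \<noteq> j" and "j \<in> S \<longleftrightarrow> i \<in> S"
  shows "image ((*v) (transvection i j)) ` coord_pair S =
    (coord_pair S :: ('a::{field,finite}^'n::finite) set set)"
  using assms transvection_image_coord_subspace[OF assms(1), where 'a='a and S=S]
    transvection_image_coord_subspace[OF assms(1), where 'a='a and S="- S"]
  unfolding coord_pair_def by simp

lemma diag_matrix_fixes_coord_pair:
  "(\<And>r. d r \<noteq> 0) \<Longrightarrow>
    image ((*v) (diag_matrix d)) ` coord_pair S = (coord_pair S :: ('a::{field,finite}^'n::finite) set set)"
  unfolding coord_pair_def by (simp add: diag_matrix_image_coord_subspace)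

text \<open>The span of the vectors \<open>e\<^sub>i + e\<^sub>\<phi>\<^sub>i\<close> for \<open>i \<in> A\<close>.\<close>

definition diag_subspace :: "'n set \<Rightarrow> ('n \<Rightarrow> 'n) \<Rightarrow> ('a::field^'n) set" where
  "diag_subspace A \<phi> = {x. (\<forall>i. i \<notin> A \<union> \<phi> ` A \<longrightarrow> x $ i = 0) \<and> (\<forall>i\<in>A. x $ \<phi> i = x $ i)}"

text \<open>The projection onto the diagonal subspace along \<open>coord_subspace (- \<phi> ` A)\<close>.\<close>

definition diag_proj :: "'n set \<Rightarrow> ('n \<Rightarrow> 'n) \<Rightarrow> 'a::field^'n \<Rightarrow> 'a^'n" where
  "diag_proj A \<phi> v = (\<chi> i. if i \<in> A then v $ \<phi> i else if i \<in> \<phi> ` A then v $ i else 0)"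

definition diag_pair :: "'n set \<Rightarrow> ('n \<Rightarrow> 'n) \<Rightarrow> ('a::field^'n) set set" where
  "diag_pair A \<phi> = {diag_subspace A \<phi>, coord_subspace (- \<phi> ` A)}"

lemma subspace_diag_subspace: "vec.subspace (diag_subspace A \<phi>)"
  unfolding vec.subspace_def diag_subspace_def by auto

lemma diag_subspace_coord_eq: "x \<in> diag_subspace A \<phi> \<Longrightarrow> i \<in> A \<Longrightarrow> x $ \<phi> i = x $ i"
  unfolding diag_subspace_def by blast

lemma diag_proj_in_diag_subspace:
  assumes "A \<inter> \<phi> ` A = {}"
  shows "diag_proj A \<phi> v \<in> diag_subspace A \<phi>"
  using assms unfolding diag_proj_def diag_subspace_def by (auto; blast)

lemma diff_diag_proj_in_coord_subspace:
  assumes "A \<inter> \<phi> ` A = {}"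
  shows "v - diag_proj A \<phi> v \<in> coord_subspace (- \<phi> ` A)"
  using assms unfolding diag_proj_def coord_subspace_def by (auto; blast)

lemma bij_betw_diag_proj:
  assumes "A \<inter> \<phi> ` A = {}"
  shows "bij_betw (diag_proj A \<phi>) (coord_subspace (\<phi> ` A)) (diag_subspace A \<phi> :: ('a::field^'n) set)"
proof (rule bij_betw_byWitness[where f' = "\<lambda>x. \<chi> i. if i \<in> \<phi> ` A then x $ i else 0"])
  show "\<forall>y\<in>coord_subspace (\<phi> ` A). (\<chi> i. if i \<in> \<phi> ` A then diag_proj A \<phi> y $ i else 0) = y"
    using assms unfolding coord_subspace_def diag_proj_def by (auto simp: vec_eq_iff)
  show "\<forall>x\<in>diag_subspace A \<phi>. diag_proj A \<phi> (\<chi> i. if i \<in> \<phi> ` A then x $ i else 0) = x"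
    unfolding diag_subspace_def diag_proj_def by (auto simp: vec_eq_iff)
  show "diag_proj A \<phi> ` coord_subspace (\<phi> ` A) \<subseteq> diag_subspace A \<phi>"
    using diag_proj_in_diag_subspace[OF assms] by blast
  show "(\<lambda>x. \<chi> i. if i \<in> \<phi> ` A then x $ i else 0) ` diag_subspace A \<phi> \<subseteq> coord_subspace (\<phi> ` A)"
    unfolding coord_subspace_def by auto
qed

lemma card_diag_subspace:
  assumes "A \<inter> \<phi> ` A = {}"
  shows "card (diag_subspace A \<phi> :: ('a::{field,finite}^'n::finite) set) =
    card (coord_subspace (\<phi> ` A) :: ('a^'n) set)"
  using bij_betw_diag_proj[OF assms] by (metis bij_betw_same_card)

lemma dim_diag_subspace:
  assumes "inj_on \<phi> A" and "A \<inter> \<phi> ` A = {}"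
  shows "vec.dim (diag_subspace A \<phi> :: ('a::{field,finite}^'n::finite) set) = card A"
proof -
  have "card (diag_subspace A \<phi> :: ('a^'n) set) = card (coord_subspace (\<phi> ` A) :: ('a^'n) set)"
    by (rule card_diag_subspace[OF assms(2)])
  then show ?thesis
    using dim_eq_if_card_eq[OF subspace_diag_subspace subspace_coord_subspace]
      dim_coord_subspace card_image[OF assms(1)] by metis
qed

lemma direct_sum_pair_diag_subspace:
  assumes "A \<inter> \<phi> ` A = {}"
  shows "direct_sum_pair (diag_subspace A \<phi>) (coord_subspace (- \<phi> ` A))"
  unfolding direct_sum_pair_iff
proof
  show "diag_subspace A \<phi> \<inter> coord_subspace (- \<phi> ` A) = {0}"
    unfolding diag_subspace_def coord_subspace_def by (auto simp: vec_eq_iff; blast)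
  have "v \<in> diag_subspace A \<phi> + coord_subspace (- \<phi> ` A)" for v
    using set_plus_intro[OF diag_proj_in_diag_subspace[OF assms, of v]
        diff_diag_proj_in_coord_subspace[OF assms, of v]]
    by simp
  then show "diag_subspace A \<phi> + coord_subspace (- \<phi> ` A) = UNIV"
    by blast
qed

lemma coord_subspace_plus_diag_subspace:
  assumes "A \<inter> \<phi> ` A = {}"
  shows "coord_subspace A + diag_subspace A \<phi> = (coord_subspace (A \<union> \<phi> ` A) :: ('a::field^'n) set)"
proof
  show "coord_subspace A + diag_subspace A \<phi> \<subseteq> (coord_subspace (A \<union> \<phi> ` A) :: ('a^'n) set)"
    unfolding set_plus_def coord_subspace_def diag_subspace_def by auto
  show "(coord_subspace (A \<union> \<phi> ` A) :: ('a^'n) set) \<subseteq> coord_subspace A + diag_subspace A \<phi>"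
  proof
    fix v :: "'a^'n" assume "v \<in> coord_subspace (A \<union> \<phi> ` A)"
    then have "v - diag_proj A \<phi> v \<in> coord_subspace A"
      unfolding coord_subspace_def diag_proj_def by auto
    from set_plus_intro[OF this diag_proj_in_diag_subspace[OF assms, of v]]
    show "v \<in> coord_subspace A + diag_subspace A \<phi>"
      by simp
  qed
qed


section \<open>Three points with dependent stabilisers\<close>

lemma semilinear_image_pair_fixed:
  fixes W U :: "('a::{field,finite}^'n::finite) set"
  assumes "semilinear_bij h" and "{h ` W, h ` U} = {W, U}" and "card W \<noteq> card U"
  shows "h ` W = W \<and> h ` U = U"
proof -
  have "card (h ` X) = card X" for X :: "('a^'n) set"
    using semilinear_bij_inj[OF assms(1)] by (simp add: card_image inj_on_subset)
  with assms(2,3) show ?thesis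
    unfolding doubleton_eq_iff by metis
qed

lemma polarity_image_pair_swapped:
  fixes W U :: "('a::{field,finite}^'n::finite) set"
  assumes "inj h" and "{perp (h ` W), perp (h ` U)} = {W, U}"
    and "card (perp U) = card W" and "card W < card U"
  shows "perp (h ` W) = U \<and> perp (h ` U) = W"
proof -
  have "perp (h ` U) \<noteq> U"
  proof
    assume "perp (h ` U) = U"
    then have "h ` U \<subseteq> perp U"
      using subset_perp_perp by metis
    then have "card U \<le> card (perp U)"
      using \<open>inj h\<close> card_mono[of "perp U" "h ` U"] by (simp add: card_image inj_on_subset)
    with assms(3,4) show False
      by simp
  qed
  with assms(2) show ?thesis
    unfolding doubleton_eq_iff by blast
qed

lemma image_eq_perp_if_perp_image_eq:
  fixes W U :: "('a::{field,finite}^'n::finite) set"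
  assumes "inj h" and "perp (h ` W) = U" and "card (perp U) = card W"
  shows "h ` W = perp U"
proof (rule card_subset_eq)
  show "h ` W \<subseteq> perp U"
    using assms(2) subset_perp_perp by metis
  show "card (h ` W) = card (perp U)"
    using assms(1,3) by (simp add: card_image inj_on_subset)
qed simp

lemma semilinear_image_plus_Int:
  "semilinear_bij h \<Longrightarrow> h ` ((X + Y) \<inter> Z) = (h ` X + h ` Y) \<inter> h ` Z"
  by (simp add: image_Int semilinear_bij_inj semilinear_image_set_plus)

locale index_pairing =
  fixes k :: nat and A :: "'n::finite set" and \<phi> :: "'n \<Rightarrow> 'n" and a0 c0 :: 'n
  assumes card_A: "card A = k" and inj_\<phi>: "inj_on \<phi> A" and disjoint: "A \<inter> \<phi> ` A = {}"
    and a0: "a0 \<in> A" and c0: "c0 \<notin> A \<union> \<phi> ` A"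
begin

lemma card_image_\<phi>: "card (\<phi> ` A) = k"
  using card_A inj_\<phi> by (simp add: card_image)

lemma \<phi>_a0: "\<phi> a0 \<in> \<phi> ` A" "\<phi> a0 \<notin> A"
  using a0 disjoint by blast+

lemma k_less_codim: "k < CARD('n) - k"
proof -
  have "card (A \<union> \<phi> ` A) < CARD('n)"
    using c0 by (intro psubset_card_mono) auto
  then show ?thesis
    using card_Un_disjoint[OF _ _ disjoint] card_A card_image_\<phi> by simp
qed

lemma card_coord_subspace_less:
  "card (coord_subspace S :: ('a::{field,finite}^'n) set) < card (coord_subspace (- T) :: ('a^'n) set)"
  if "card S = k" "card T = k"
  using that k_less_codim one_less_card_field[where 'a='a]
  by (simp add: card_coord_subspace card_Compl_finite power_strict_increasing)

lemma diag_pair_in_Omega1: "(diag_pair A \<phi> :: ('a::{field,finite}^'n) set set) \<in> Omega1 k"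
  unfolding diag_pair_def
  by (intro Omega1_memI subspace_diag_subspace subspace_coord_subspace
      direct_sum_pair_diag_subspace disjoint)
    (simp_all add: dim_diag_subspace[OF inj_\<phi> disjoint] dim_coord_subspace card_Compl_finite
      card_A card_image_\<phi>)

lemma Un_image_Int_Compl: "(A \<union> \<phi> ` A) \<inter> - A = \<phi> ` A"
  using disjoint by blast

lemma coord_subspace_lattice:
  "(coord_subspace A + diag_subspace A \<phi>) \<inter> coord_subspace (- A) =
    (coord_subspace (\<phi> ` A) :: ('a::field^'n) set)"
  "(coord_subspace A + coord_subspace (\<phi> ` A)) \<inter> coord_subspace (- A) =
    (coord_subspace (\<phi> ` A) :: ('a::field^'n) set)"
  by (simp_all add: coord_subspace_plus_diag_subspace[OF disjoint] coord_subspace_plus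
      coord_subspace_Int Un_image_Int_Compl)

lemma coord_subspace_image_neq_diag_subspace:
  "coord_subspace (\<phi> ` A) \<noteq> (diag_subspace A \<phi> :: ('a::field^'n) set)"
proof -
  have "axis (\<phi> a0) (1::'a) $ \<phi> a0 \<noteq> axis (\<phi> a0) 1 $ a0"
    using a0 \<phi>_a0 by (auto simp: axis_def)
  then have "axis (\<phi> a0) 1 \<notin> (diag_subspace A \<phi> :: ('a^'n) set)"
    using diag_subspace_coord_eq[OF _ a0] by blast
  moreover have "axis (\<phi> a0) 1 \<in> (coord_subspace (\<phi> ` A) :: ('a^'n) set)"
    using \<phi>_a0 by (simp add: axis_in_coord_subspace_iff)
  ultimately show ?thesis
    by blast
qed

lemma semilinear_fixing_coord_and_diag_pair_fixes_coord_pair_\<phi>: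
  fixes h :: "'a::{field,finite}^'n \<Rightarrow> 'a^'n"
  assumes h: "semilinear_bij h"
    and P1: "image h ` coord_pair A = coord_pair A" and P2: "image h ` diag_pair A \<phi> = diag_pair A \<phi>"
  shows "image h ` coord_pair (\<phi> ` A) = coord_pair (\<phi> ` A)"
proof -
  let ?A = "coord_subspace A :: ('a^'n) set" and ?nA = "coord_subspace (- A) :: ('a^'n) set"
    and ?B = "coord_subspace (\<phi> ` A) :: ('a^'n) set" and ?nB = "coord_subspace (- \<phi> ` A) :: ('a^'n) set"
    and ?D = "diag_subspace A \<phi> :: ('a^'n) set"
  have "h ` ?A = ?A \<and> h ` ?nA = ?nA"
    using semilinear_image_pair_fixed[OF h, of ?A ?nA] P1 card_coord_subspace_less[OF card_A card_A, where 'a='a]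
    unfolding coord_pair_def by simp
  moreover have "h ` ?D = ?D \<and> h ` ?nB = ?nB"
    using semilinear_image_pair_fixed[OF h, of ?D ?nB] P2 card_diag_subspace[OF disjoint, where 'a='a]
      card_coord_subspace_less[OF card_image_\<phi> card_image_\<phi>, where 'a='a]
    unfolding diag_pair_def by simp
  moreover have "h ` ?B = (h ` ?A + h ` ?D) \<inter> h ` ?nA"
    using semilinear_image_plus_Int[OF h, of ?A ?D ?nA] coord_subspace_lattice(1)[where 'a='a]
    by simp
  ultimately show ?thesis
    using coord_subspace_lattice(1)[where 'a='a] unfolding coord_pair_def by simp
qed

text \<open>Otherwise h fixes \<open>\<langle>A\<rangle>\<close> and \<open>\<langle>-A\<rangle>\<close> and maps D onto \<open>\<langle>\<phi> A\<rangle>\<close>. As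
  \<open>(\<langle>A\<rangle> + D) \<inter> \<langle>-A\<rangle> = \<langle>\<phi> A\<rangle> = (\<langle>A\<rangle> + \<langle>\<phi> A\<rangle>) \<inter> \<langle>-A\<rangle>\<close>, h then maps
  \<open>\<langle>\<phi> A\<rangle>\<close> onto itself as well, forcing \<open>D = \<langle>\<phi> A\<rangle>\<close>.\<close>

lemma polarity_cannot_fix_coord_and_diag_pair:
  fixes h :: "'a::{field,finite}^'n \<Rightarrow> 'a^'n"
  assumes h: "semilinear_bij h" and P1: "perp ` image h ` coord_pair A = coord_pair A"
  shows "perp ` image h ` diag_pair A \<phi> \<noteq> diag_pair A \<phi>"
proof
  assume P2: "perp ` image h ` diag_pair A \<phi> = diag_pair A \<phi>"
  let ?A = "coord_subspace A :: ('a^'n) set" and ?nA = "coord_subspace (- A) :: ('a^'n) set"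
    and ?B = "coord_subspace (\<phi> ` A) :: ('a^'n) set" and ?nB = "coord_subspace (- \<phi> ` A) :: ('a^'n) set"
    and ?D = "diag_subspace A \<phi> :: ('a^'n) set"
  have inj: "inj h"
    using semilinear_bij_inj[OF h] .
  have "perp (h ` ?A) = ?nA \<and> perp (h ` ?nA) = ?A"
    using polarity_image_pair_swapped[OF inj, of ?A ?nA] P1 card_coord_subspace_less[OF card_A card_A, where 'a='a]
    unfolding coord_pair_def by (simp add: perp_coord_subspace)
  then have "h ` ?A = ?A" "h ` ?nA = ?nA"
    using image_eq_perp_if_perp_image_eq[OF inj, of ?A ?nA]
      image_eq_perp_if_perp_image_eq[OF inj, of ?nA ?A]
    by (simp_all add: perp_coord_subspace)
  moreover have "perp (h ` ?D) = ?nB"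
    using polarity_image_pair_swapped[OF inj, of ?D ?nB] P2 card_diag_subspace[OF disjoint, where 'a='a]
      card_coord_subspace_less[OF card_image_\<phi> card_image_\<phi>, where 'a='a]
    unfolding diag_pair_def by (simp add: perp_coord_subspace)
  then have "h ` ?D = ?B"
    using image_eq_perp_if_perp_image_eq[OF inj, of ?D ?nB] card_diag_subspace[OF disjoint, where 'a='a]
    by (simp add: perp_coord_subspace)
  moreover have "h ` ?B = (h ` ?A + h ` ?D) \<inter> h ` ?nA"
    using semilinear_image_plus_Int[OF h, of ?A ?D ?nA] coord_subspace_lattice(1)[where 'a='a]
    by simp
  ultimately have "h ` ?B = h ` ?D"
    using coord_subspace_lattice(2)[where 'a='a] by simp
  then show False
    using inj coord_subspace_image_neq_diag_subspace[where 'a='a] by (simp add: inj_image_eq_iff)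
qed

lemma Aut_on_fixing_coord_and_diag_pair_fixes_coord_pair_\<phi>:
  fixes g :: "('a::{field,finite}^'n) set set \<Rightarrow> ('a^'n) set set"
  assumes "g \<in> Aut_on k" and "g (coord_pair A) = coord_pair A" and "g (diag_pair A \<phi>) = diag_pair A \<phi>"
  shows "g (coord_pair (\<phi> ` A)) = coord_pair (\<phi> ` A)"
  using assms(1)
proof (cases rule: Aut_onE)
  case (PGammaL h)
  then show ?thesis
    using assms(2,3) semilinear_fixing_coord_and_diag_pair_fixes_coord_pair_\<phi>
      coord_pair_in_Omega1 card_A card_image_\<phi> diag_pair_in_Omega1 by metis
next
  case (polarity h)
  then show ?thesis
    using assms(2,3) polarity_cannot_fix_coord_and_diag_pair
      coord_pair_in_Omega1[OF card_A] diag_pair_in_Omega1 by metis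
qed

lemma PSL_on_moves_coord_pair:
  "\<exists>g\<in>PSL_on k. g (coord_pair A) \<noteq> (coord_pair A :: ('a::{field,finite}^'n) set set)"
proof -
  let ?M = "transvection (\<phi> a0) a0 :: 'a^'n^'n"
  have "\<phi> a0 \<noteq> a0"
    using a0 \<phi>_a0 by auto
  then have "induced (image ((*v) ?M)) (Omega1 k) \<in> PSL_on k"
    by (intro matrix_in_PSL_on det_transvection)
  moreover have "induced (image ((*v) ?M)) (Omega1 k) (coord_pair A) \<noteq> coord_pair A"
    using transvection_moves_coord_pair[OF \<phi>_a0(2) a0]
    by (simp add: induced_apply[OF coord_pair_in_Omega1[OF card_A]])
  ultimately show ?thesis
    by blast
qed

lemma PSL_on_fixes_coord_pair_moves_coord_pair_\<phi>:
  "\<exists>g\<in>PSL_on k. g (coord_pair A) = (coord_pair A :: ('a::{field,finite}^'n) set set)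
     \<and> g (coord_pair (\<phi> ` A)) \<noteq> coord_pair (\<phi> ` A)"
proof -
  let ?M = "transvection c0 (\<phi> a0) :: 'a^'n^'n"
  have "c0 \<noteq> \<phi> a0"
    using c0 \<phi>_a0 by auto
  then have "induced (image ((*v) ?M)) (Omega1 k) \<in> PSL_on k"
    by (intro matrix_in_PSL_on det_transvection)
  moreover have "induced (image ((*v) ?M)) (Omega1 k) (coord_pair A) = coord_pair A"
    using transvection_fixes_coord_pair[OF \<open>c0 \<noteq> \<phi> a0\<close>, of A] c0 \<phi>_a0
    by (simp add: induced_apply[OF coord_pair_in_Omega1[OF card_A]])
  moreover have "induced (image ((*v) ?M)) (Omega1 k) (coord_pair (\<phi> ` A)) \<noteq> coord_pair (\<phi> ` A)"
    using transvection_moves_coord_pair[of c0 "\<phi> ` A" "\<phi> a0"] c0 \<phi>_a0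
    by (simp add: induced_apply[OF coord_pair_in_Omega1[OF card_image_\<phi>]])
  ultimately show ?thesis
    by blast
qed

lemma diag_matrix_moves_diag_pair:
  assumes "d a0 \<noteq> d (\<phi> a0)" and "d (\<phi> a0) \<noteq> 0"
  shows "image ((*v) (diag_matrix d)) ` diag_pair A \<phi> \<noteq>
    (diag_pair A \<phi> :: ('a::{field,finite}^'n) set set)"
proof -
  let ?u = "axis a0 1 + axis (\<phi> a0) 1 :: 'a^'n"
  have "?u \<in> diag_subspace A \<phi>"
    using a0 disjoint inj_on_eq_iff[OF inj_\<phi> _ a0]
    unfolding diag_subspace_def by (auto simp: axis_def)
  moreover have "(diag_matrix d *v ?u) $ a0 = d a0" "(diag_matrix d *v ?u) $ \<phi> a0 = d (\<phi> a0)"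
    using a0 \<phi>_a0 by (auto simp: diag_matrix_apply axis_def)
  then have "(diag_matrix d *v ?u) $ \<phi> a0 \<noteq> (diag_matrix d *v ?u) $ a0"
    using assms(1) by simp
  then have "diag_matrix d *v ?u \<notin> diag_subspace A \<phi>"
    using diag_subspace_coord_eq[OF _ a0] by blast
  moreover have "diag_matrix d *v ?u \<notin> coord_subspace (- \<phi> ` A)"
  proof
    assume "diag_matrix d *v ?u \<in> coord_subspace (- \<phi> ` A)"
    then have "(diag_matrix d *v ?u) $ \<phi> a0 = 0"
      by (rule coord_subspaceD) (simp add: \<phi>_a0(1))
    with \<open>(diag_matrix d *v ?u) $ \<phi> a0 = d (\<phi> a0)\<close> assms(2) show False
      by simp
  qed
  ultimately show ?thesis
    unfolding diag_pair_def by (simp add: image_pair_neq)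
qed

lemma PSL_on_fixes_coord_pairs_moves_diag_pair:
  assumes "CARD('a::{field,finite}) \<noteq> 2"
  shows "\<exists>g\<in>PSL_on k. g (coord_pair A) = (coord_pair A :: ('a^'n) set set)
     \<and> g (coord_pair (\<phi> ` A)) = coord_pair (\<phi> ` A) \<and> g (diag_pair A \<phi>) \<noteq> diag_pair A \<phi>"
proof -
  obtain l :: 'a where l: "l \<noteq> 0" "l \<noteq> 1"
    using ex_field_elem_neq_0_1[OF assms] by blast
  define d where "d r = (if r = \<phi> a0 then l else if r = c0 then inverse l else 1)" for r
  have "\<phi> a0 \<noteq> c0" "a0 \<noteq> \<phi> a0" "a0 \<noteq> c0"
    using a0 c0 \<phi>_a0 by auto
  then have d: "d (\<phi> a0) = l" "d a0 = 1" "\<And>r. d r \<noteq> 0"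
    using l by (auto simp: d_def)
  have "prod d UNIV = prod d {\<phi> a0, c0}"
    by (rule prod.mono_neutral_right) (auto simp: d_def)
  then have "det (diag_matrix d :: 'a^'n^'n) = 1"
    using \<open>\<phi> a0 \<noteq> c0\<close> l by (simp add: det_diag_matrix d_def)
  define g where "g = induced (image ((*v) (diag_matrix d))) (Omega1 k :: ('a^'n) set set set)"
  have "g \<in> PSL_on k"
    unfolding g_def by (rule matrix_in_PSL_on) fact
  moreover have "g (coord_pair A) = coord_pair A" "g (coord_pair (\<phi> ` A)) = coord_pair (\<phi> ` A)"
    using diag_matrix_fixes_coord_pair[OF d(3)] unfolding g_def
    by (simp_all add: induced_apply coord_pair_in_Omega1 card_A card_image_\<phi>)
  moreover have "g (diag_pair A \<phi>) \<noteq> diag_pair A \<phi>"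
    using diag_matrix_moves_diag_pair[of d] d l unfolding g_def
    by (simp add: induced_apply diag_pair_in_Omega1)
  ultimately show ?thesis
    by blast
qed

lemma iota_on_fixes_coord_pairs_moves_diag_pair:
  "iota_on k (coord_pair A) = (coord_pair A :: ('a::{field,finite}^'n) set set)
     \<and> iota_on k (coord_pair (\<phi> ` A)) = (coord_pair (\<phi> ` A) :: ('a^'n) set set)
     \<and> iota_on k (diag_pair A \<phi>) \<noteq> (diag_pair A \<phi> :: ('a^'n) set set)"
proof -
  have "coord_subspace (\<phi> ` A) \<noteq> (coord_subspace (- \<phi> ` A) :: ('a^'n) set)"
    using card_coord_subspace_less[OF card_image_\<phi> card_image_\<phi>, where 'a='a] by auto
  then have "perp ` diag_pair A \<phi> \<noteq> (diag_pair A \<phi> :: ('a^'n) set set)"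
    using coord_subspace_image_neq_diag_subspace[where 'a='a]
    unfolding diag_pair_def by (auto simp: perp_coord_subspace doubleton_eq_iff)
  then show ?thesis
    unfolding iota_on_def
    by (simp add: induced_apply perp_image_coord_pair coord_pair_in_Omega1 card_A card_image_\<phi>
        diag_pair_in_Omega1)
qed

lemma not_IBIS:
  fixes G :: "(('a::{field,finite}^'n) set set \<Rightarrow> ('a^'n) set set) set"
  assumes G: "subgroup G (BijGroup (Omega1 k))" and "PSL_on k \<subseteq> G" and "G \<subseteq> Aut_on k"
    and "CARD('a) = 2 \<Longrightarrow> iota_on k \<in> G"
  shows "\<not> IBIS (Omega1 k) G"
proof -
  define P1 Q P2 where "P1 = (coord_pair A :: ('a^'n) set set)"
    and "Q = (coord_pair (\<phi> ` A) :: ('a^'n) set set)" and "P2 = (diag_pair A \<phi> :: ('a^'n) set set)"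
  have "\<exists>g\<in>G. g P1 \<noteq> P1"
    using PSL_on_moves_coord_pair assms(2) unfolding P1_def by blast
  moreover have "\<exists>g\<in>G. g P1 = P1 \<and> g Q \<noteq> Q"
    using PSL_on_fixes_coord_pair_moves_coord_pair_\<phi> assms(2) unfolding P1_def Q_def by blast
  moreover have "\<exists>g\<in>G. g P1 = P1 \<and> g Q = Q \<and> g P2 \<noteq> P2"
    using PSL_on_fixes_coord_pairs_moves_diag_pair iota_on_fixes_coord_pairs_moves_diag_pair assms(2,4)
    unfolding P1_def Q_def P2_def by blast
  ultimately have "irredundant_seq G [P1, Q, P2]"
    unfolding irredundant_seq_iff_moved by (auto simp: less_Suc_eq pw_stab_def)
  moreover have "pw_stab G [P1, P2] \<subseteq> pw_stab G [P1, Q, P2]"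
    using Aut_on_fixing_coord_and_diag_pair_fixes_coord_pair_\<phi> assms(3)
    unfolding P1_def Q_def P2_def pw_stab_def by auto
  moreover have "set [P1, Q, P2] \<subseteq> Omega1 k"
    using coord_pair_in_Omega1[OF card_A] coord_pair_in_Omega1[OF card_image_\<phi>] diag_pair_in_Omega1
    unfolding P1_def Q_def P2_def by simp
  ultimately show ?thesis
    using not_IBIS_if_shorter_seq_fixes[OF G, of "[P1, Q, P2]" "[P1, P2]"] by simp
qed

end

lemma index_pairing_exists:
  assumes "1 \<le> k" and "2 * k < CARD('n::finite)"
  obtains A \<phi> a0 c0 where "index_pairing k A (\<phi> :: 'n \<Rightarrow> 'n) a0 c0"
proof -
  obtain A :: "'n set" where A: "card A = k"
    using obtain_subset_with_card_n[of k "UNIV :: 'n set"] assms(2) by auto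
  moreover have "k \<le> card (- A)"
    using A assms(2) by (simp add: card_Compl_finite)
  then obtain B where B: "B \<subseteq> - A" "card B = k"
    by (metis obtain_subset_with_card_n)
  moreover obtain \<phi> where "bij_betw \<phi> A B"
    using finite_same_card_bij[of A B] A B(2) by auto
  moreover have "A \<inter> B = {}"
    using B(1) by blast
  then have "card (A \<union> B) < CARD('n)"
    using A B(2) assms(2) by (simp add: card_Un_disjoint)
  then have "A \<union> B \<noteq> UNIV"
    by auto
  then obtain c0 where "c0 \<notin> A \<union> B"
    by blast
  moreover obtain a0 where "a0 \<in> A"
    using A assms(1) by fastforce
  ultimately have "index_pairing k A \<phi> a0 c0"
    by unfold_locales (auto simp: bij_betw_def)
  then show ?thesis
    using that by blast
qed

theorem lemma3p5:
  fixes G :: "(('a::{field,finite}^'n::finite) set set \<Rightarrow> ('a^'n) set set) set"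
    and k :: nat
  assumes "CARD('n) \<ge> 3"
    and "1 \<le> k" and "2 * k < CARD('n)"
    and "subgroup G (BijGroup (Omega1 k :: ('a^'n) set set set))"
    and "normal (PSL_on k) ((BijGroup (Omega1 k :: ('a^'n) set set set))\<lparr>carrier := G\<rparr>)"
    and "G \<subseteq> Aut_on k"
    and "\<not> G \<subseteq> PGammaL_on k"
  shows "\<not> IBIS (Omega1 k :: ('a^'n) set set set) G"
proof -
  \<comment> \<open>The hypothesis \<open>CARD('n) \<ge> 3\<close> is implied by \<open>1 \<le> k\<close> and \<open>2 * k < CARD('n)\<close>.\<close>
  have PSL: "PSL_on k \<subseteq> G"
    using normal_imp_subgroup[OF assms(5)] subgroup.subset by fastforce
  obtain A \<phi> a0 c0 where "index_pairing k A (\<phi> :: 'n \<Rightarrow> 'n) a0 c0"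
    using index_pairing_exists[OF assms(2,3)] by blast
  then show ?thesis
    using index_pairing.not_IBIS[OF _ assms(4) PSL assms(6)]
      iota_on_in_subgroup_if_card_2[OF assms(4) PSL assms(6,7)] by blast
qed

end
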